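(* Let $k$ be a field and let $<$ be a monomial preorder of $k[X]=k[x_1,\dots,x_n]$. Then there is a real $m\times n$ matrix $M$ for some $m>0$ such that, for all $a,b\in\mathbb{N}^n$, $x^a<x^b$ if and only if $M\cdot a<_{\mathrm{lex}}M\cdot b$.
   Context: For $a=(\alpha_1,\dots,\alpha_n)\in\mathbb{N}^n$ write $x^a=x_1^{\alpha_1}\cdots x_n^{\alpha_n}$. A (strict) partial order on a set is an irreflexive, asymmetric, transitive relation $<$; two elements $s,t$ are incomparable if neither $s<t$ nor $t<s$; $<$ is a weak order if incomparability is an equivalence relation. A monomial preorder of $k[X]$ is a weak order $<$ on the set of monomials of $k[X]$ such that for all $a,b,c\in\mathbb{N}^n$: $x^a<x^b$ implies $x^ax^c<x^bx^c$, and $x^ax^c<x^bx^c$ implies $x^a<x^b$. Here $<_{\mathrm{lex}}$ is the (strict) lexicographic order on $\mathbb{R}^m$. *)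

theory Defs
  imports Complex_Main "HOL-Library.Poly_Mapping" "Jordan_Normal_Form.Matrix"
begin

text \<open>
  Finitely supported maps from finitely supported exponents to coefficients form the polynomial
  ring in the countably many variables \<open>X 0, X 1, \<dots>\<close>; the ring in \<open>n\<close> variables is its subring
  in \<open>X 0, \<dots>, X (n - 1)\<close>, so variables and vector entries are both numbered from 0.
\<close>

type_synonym 'k mpoly = "(nat \<Rightarrow>\<^sub>0 nat) \<Rightarrow>\<^sub>0 'k"

definition X :: "nat \<Rightarrow> 'k::field mpoly" where
  "X i = Poly_Mapping.single (Poly_Mapping.single i 1) 1"

definition xpow :: "nat vec \<Rightarrow> 'k::field mpoly" where
  "xpow a = (\<Prod>i<dim_vec a. X i ^ (a $ i))"

definition monomials :: "nat \<Rightarrow> 'k::field mpoly set" where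
  "monomials n = xpow ` carrier_vec n"

text \<open>Order relations on a set \<open>S\<close> are predicates whose values outside \<open>S\<close> are irrelevant.\<close>

definition strict_partial_order_on :: "'a set \<Rightarrow> ('a \<Rightarrow> 'a \<Rightarrow> bool) \<Rightarrow> bool" where
  "strict_partial_order_on S lt \<longleftrightarrow> irreflp_on S lt \<and> asymp_on S lt \<and> transp_on S lt"

definition incomparable :: "('a \<Rightarrow> 'a \<Rightarrow> bool) \<Rightarrow> 'a \<Rightarrow> 'a \<Rightarrow> bool" where
  "incomparable lt s t \<longleftrightarrow> \<not> lt s t \<and> \<not> lt t s"

definition weak_order_on :: "'a set \<Rightarrow> ('a \<Rightarrow> 'a \<Rightarrow> bool) \<Rightarrow> bool" where
  "weak_order_on S lt \<longleftrightarrow>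
     strict_partial_order_on S lt \<and> equiv S {(s, t). s \<in> S \<and> t \<in> S \<and> incomparable lt s t}"

definition monomial_preorder :: "nat \<Rightarrow> ('k::field mpoly \<Rightarrow> 'k mpoly \<Rightarrow> bool) \<Rightarrow> bool" where
  "monomial_preorder n lt \<longleftrightarrow>
     weak_order_on (monomials n) lt \<and>
     (\<forall>a\<in>carrier_vec n. \<forall>b\<in>carrier_vec n. \<forall>c\<in>carrier_vec n.
        (lt (xpow a) (xpow b) \<longrightarrow> lt (xpow a * xpow c) (xpow b * xpow c)) \<and>
        (lt (xpow a * xpow c) (xpow b * xpow c) \<longrightarrow> lt (xpow a) (xpow b)))"

text \<open>Intended for vectors of equal dimension.\<close>

definition lex_less :: "real vec \<Rightarrow> real vec \<Rightarrow> bool" (infix \<open><\<^sub>l\<^sub>e\<^sub>x\<close> 50) where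
  "u <\<^sub>l\<^sub>e\<^sub>x v \<longleftrightarrow> (\<exists>i<dim_vec u. u $ i < v $ i \<and> (\<forall>j<i. u $ j = v $ j))"

end

theory Submission
  imports Defs "HOL-Analysis.Elementary_Metric_Spaces" "HOL-Library.Function_Algebras"
begin

text \<open>
  The set \<open>P\<close> of differences \<open>b - a\<close> with \<open>x\<^sup>a < x\<^sup>b\<close> is an additive subsemigroup of \<open>\<int>\<^sup>n\<close> without 0,
  and it decides the preorder. Finitely many elements of \<open>P\<close> lie in a common open half-space
  (Gordan's theorem over the integers), so by compactness some nonzero real functional \<open>g\<close> is
  nonnegative on \<open>P\<close>. It vanishes on every \<open>z\<close> incomparable to 0, because \<open>p + k z \<in> P\<close> for all
  \<open>p \<in> P\<close> and \<open>k \<in> \<int>\<close>. Hence \<open>g\<close> decides membership in \<open>P\<close> off its kernel; it is taken as the next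
  row of the matrix, and one recurses on the kernel, whose dimension is smaller.
\<close>

section \<open>Gordan's theorem over the integers\<close>

text \<open>
  Induction on the family: project it along one of its members \<open>v w\<close>. Either the projections
  satisfy the hypothesis and the resulting functional is perturbed by \<open>v w\<close>, or \<open>v w\<close> is itself a
  positive rational combination of the other members.
\<close>

lemma gordan_int:
  fixes v :: "'i \<Rightarrow> nat \<Rightarrow> int"
  assumes "finite I"
    and "\<And>t. \<forall>s\<in>I. 0 \<le> t s \<Longrightarrow> \<forall>i<n. (\<Sum>s\<in>I. t s * v s i) = 0 \<Longrightarrow> \<forall>s\<in>I. t s = 0"
  shows "\<exists>f. \<forall>s\<in>I. 0 < (\<Sum>i<n. f i * v s i)"
  using assms
proof (induction I arbitrary: v rule: finite_induct)
  case empty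
  then show ?case by simp
next
  case (insert w I v)
  define dot :: "(nat \<Rightarrow> int) \<Rightarrow> (nat \<Rightarrow> int) \<Rightarrow> int" where "dot x y = (\<Sum>i<n. x i * y i)" for x y
  have dot_commute: "dot x y = dot y x" for x y
    by (simp add: dot_def mult.commute)
  have dot_lin: "dot (\<lambda>i. a * x i + b * z i) y = a * dot x y + b * dot z y" for a b x y z
    by (simp add: dot_def sum.distrib sum_distrib_left algebra_simps)
  have dot_diff: "dot (\<lambda>i. a * x i - b * z i) y = a * dot x y - b * dot z y" for a b x y z
    by (simp add: dot_def sum_subtractf sum_distrib_left algebra_simps)
  have dot_sum: "dot f (\<lambda>i. \<Sum>s\<in>I. t s * v s i) = (\<Sum>s\<in>I. t s * dot f (v s))" for f t
    unfolding dot_def sum_distrib_left by (subst sum.swap) (simp add: algebra_simps)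
  define q where "q = dot (v w) (v w)"
  have q: "q > 0"
  proof (rule ccontr)
    assume "\<not> q > 0"
    moreover have "q \<ge> 0" by (simp add: q_def dot_def sum_nonneg)
    ultimately have "q = 0" by simp
    then have z: "\<forall>i<n. v w i = 0"
      unfolding q_def dot_def by (subst (asm) sum_nonneg_eq_0_iff) auto
    \<comment> \<open>If \<open>v w\<close> vanished, the coefficients 1 at \<open>w\<close> and 0
      elsewhere would form a relation that the hypothesis excludes.\<close>
    have "\<forall>i<n. (\<Sum>s\<in>insert w I. (if s = w then 1 else 0) * v s i) = 0"
      using z by (auto intro!: sum.neutral)
    from insert.prems[OF _ this] show False by fastforce
  qed
  \<comment> \<open>The component of \<open>v s\<close> orthogonal to \<open>v w\<close>, scaled by
    \<open>q\<close> so that it stays integral.\<close>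
  define u where "u s = (\<lambda>i. q * v s i - dot (v s) (v w) * v w i)" for s
  show ?case
  proof (cases "\<forall>t. (\<forall>s\<in>I. 0 \<le> t s) \<longrightarrow> (\<forall>i<n. (\<Sum>s\<in>I. t s * u s i) = 0) \<longrightarrow> (\<forall>s\<in>I. t s = 0)")
    case True
    then obtain f where f: "\<And>s. s \<in> I \<Longrightarrow> 0 < dot f (u s)"
      using insert.IH[of u] unfolding dot_def by blast
    \<comment> \<open>The same scaled projection applied to \<open>f\<close>. It is self-adjoint, so
      \<open>g\<close> takes on \<open>v s\<close> the value of \<open>f\<close> on
      \<open>u s\<close>, while \<open>g\<close> kills \<open>v w\<close>. Perturbing a multiple of
      \<open>g\<close> by \<open>v w\<close> therefore makes \<open>v w\<close> positive.\<close>
    define g where "g = (\<lambda>i. q * f i - dot f (v w) * v w i)"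
    \<comment> \<open>Over \<open>I\<close> the values of \<open>g\<close> are positive integers,
      hence at least 1. So \<open>N * g\<close> contributes at least \<open>N\<close>, and the
      perturbation can take away at most \<open>N - 1\<close>.\<close>
    define N where "N = 1 + (\<Sum>s\<in>I. \<bar>dot (v w) (v s)\<bar>)"
    define h where "h = (\<lambda>i. N * g i + 1 * v w i)"
    have gs: "dot g (v s) = dot f (u s)" for s
    proof -
      have "dot f (u s) = dot (u s) f" by (rule dot_commute)
      also have "\<dots> = q * dot (v s) f - dot (v s) (v w) * dot (v w) f"
        unfolding u_def by (rule dot_diff)
      finally show ?thesis
        unfolding g_def dot_diff
        by (simp add: dot_commute[of "v s" f] dot_commute[of "v w" f] dot_commute[of "v w" "v s"])
    qed
    have gw: "dot g (v w) = 0"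
      unfolding g_def dot_diff by (simp add: q_def)
    have "0 < dot h (v s)" if "s \<in> I" for s
    proof -
      have "\<bar>dot (v w) (v s)\<bar> \<le> N - 1"
        using member_le_sum[of s I "\<lambda>s. \<bar>dot (v w) (v s)\<bar>"] that insert.hyps by (simp add: N_def)
      moreover have "N * 1 \<le> N * dot g (v s)"
        using f[OF that] by (intro mult_left_mono) (auto simp: gs N_def intro!: add_nonneg_nonneg sum_nonneg)
      ultimately show ?thesis unfolding h_def dot_lin by simp
    qed
    moreover have "0 < dot h (v w)"
      unfolding h_def dot_lin using q by (simp add: gw q_def)
    ultimately show ?thesis unfolding dot_def by blast
  next
    case False
    then obtain t s0 where t: "\<And>s. s \<in> I \<Longrightarrow> 0 \<le> t s" and tu: "\<And>i. i < n \<Longrightarrow> (\<Sum>s\<in>I. t s * u s i) = 0"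
      and s0: "s0 \<in> I" "t s0 \<noteq> 0" by blast
    \<comment> \<open>Undoing the projection turns the relation among the \<open>u s\<close> into
      one that expresses \<open>c * v w\<close> as \<open>q\<close> times the combination of the
      \<open>v s\<close> with coefficients \<open>t s\<close>.\<close>
    define c where "c = (\<Sum>s\<in>I. t s * dot (v s) (v w))"
    have eq: "q * (\<Sum>s\<in>I. t s * v s i) = c * v w i" if "i < n" for i
      using tu[OF that]
      by (simp add: u_def c_def sum_subtractf sum_distrib_left sum_distrib_right algebra_simps)
    have c: "c > 0"
    proof (rule ccontr)
      assume "\<not> c > 0"
      \<comment> \<open>For \<open>c\<close> \<le> 0, moving \<open>c * v w\<close> to the other
        side gives a nonnegative relation in the whole family. It is nontrivial at \<open>s0\<close>
        because \<open>q\<close> and \<open>t s0\<close> are nonzero.\<close>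
      define t' where "t' s = (if s = w then - c else q * t s)" for s
      have "\<forall>s\<in>insert w I. 0 \<le> t' s"
        using t q \<open>\<not> c > 0\<close> by (auto simp: t'_def)
      moreover have "(\<Sum>s\<in>insert w I. t' s * v s i) = 0" if "i < n" for i
      proof -
        have "(\<Sum>s\<in>I. t' s * v s i) = (\<Sum>s\<in>I. q * (t s * v s i))"
          using insert.hyps by (intro sum.cong) (auto simp: t'_def)
        then show ?thesis
          using insert.hyps eq[OF that] by (simp add: t'_def sum_distrib_left)
      qed
      ultimately have "t' s0 = 0" using insert.prems s0 by blast
      then show False using s0 q insert.hyps by (auto simp: t'_def split: if_splits)
    qed
    \<comment> \<open>A relation over \<open>I\<close> extends by 0 at \<open>w\<close>, so the
      induction hypothesis applies to the unprojected vectors. Positivity on \<open>v w\<close> then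
      comes for free, since \<open>c * v w\<close> is a nontrivial nonnegative combination of
      them.\<close>
    have "\<exists>f. \<forall>s\<in>I. 0 < (\<Sum>i<n. f i * v s i)"
    proof (rule insert.IH)
      fix r assume r: "\<forall>s\<in>I. 0 \<le> r s" "\<forall>i<n. (\<Sum>s\<in>I. r s * v s i) = 0"
      define r' where "r' s = (if s = w then 0 else r s)" for s
      have "(\<Sum>s\<in>insert w I. r' s * v s i) = (\<Sum>s\<in>I. r s * v s i)" for i
        using insert.hyps by (simp add: r'_def) (intro sum.cong, auto)
      then have "\<forall>s\<in>insert w I. r' s = 0"
        using insert.prems[of r'] r by (auto simp: r'_def)
      then show "\<forall>s\<in>I. r s = 0"
        using insert.hyps by (auto simp: r'_def split: if_splits)
    qed
    then obtain f where f: "\<And>s. s \<in> I \<Longrightarrow> 0 < dot f (v s)"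
      unfolding dot_def by blast
    have "c * dot f (v w) = dot f (\<lambda>i. c * v w i)"
      by (simp add: dot_def sum_distrib_left algebra_simps)
    also have "\<dots> = dot f (\<lambda>i. q * (\<Sum>s\<in>I. t s * v s i))"
      unfolding dot_def by (intro sum.cong) (auto simp: eq)
    also have "\<dots> = q * dot f (\<lambda>i. \<Sum>s\<in>I. t s * v s i)"
      by (simp add: dot_def sum_distrib_left algebra_simps)
    also have "\<dots> = q * (\<Sum>s\<in>I. t s * dot f (v s))"
      by (simp add: dot_sum)
    also have "\<dots> > 0"
    proof -
      have "0 < t s0 * dot f (v s0)"
        using t[of s0] s0 f[of s0] by (intro mult_pos_pos) auto
      moreover have "\<forall>s\<in>I. 0 \<le> t s * dot f (v s)"
        using t f by (simp add: less_imp_le)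
      ultimately have "0 < (\<Sum>s\<in>I. t s * dot f (v s))"
        using insert.hyps s0 by (intro sum_pos2[of _ s0]) auto
      then show ?thesis using q by simp
    qed
    finally have "0 < dot f (v w)" using c by (simp add: zero_less_mult_iff)
    then show ?thesis using f unfolding dot_def by blast
  qed
qed

section \<open>Compactness in finitely many coordinates\<close>

text \<open>Bolzano-Weierstrass is applied to one coordinate at a time; passing to a further
  subsequence keeps the limits already obtained.\<close>

lemma bounded_family_convergent_subseq:
  fixes g :: "nat \<Rightarrow> 'i \<Rightarrow> real"
  assumes "finite J" "\<And>k j. j \<in> J \<Longrightarrow> \<bar>g k j\<bar> \<le> B"
  shows "\<exists>l r. strict_mono r \<and> (\<forall>j\<in>J. (\<lambda>k. g (r k) j) \<longlonglongrightarrow> l j)"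
  using assms
proof (induction J rule: finite_induct)
  case empty
  show ?case by (auto simp: strict_mono_def intro!: exI[of _ "id :: nat \<Rightarrow> nat"])
next
  case (insert a J)
  then obtain l r where r: "strict_mono r" and l: "\<And>j. j \<in> J \<Longrightarrow> (\<lambda>k. g (r k) j) \<longlonglongrightarrow> l j"
    by blast
  have "bounded (range (\<lambda>k. g (r k) a))"
    using insert.prems by (auto simp: bounded_iff)
  then obtain m r' where r': "strict_mono r'" and m: "((\<lambda>k. g (r k) a) \<circ> r') \<longlonglongrightarrow> m"
    using bounded_imp_convergent_subsequence by blast
  have "(\<lambda>k. g ((r \<circ> r') k) j) \<longlonglongrightarrow> (l(a := m)) j" if "j \<in> insert a J" for j
    using that m LIMSEQ_subseq_LIMSEQ[OF l r'] insert.hyps by (auto simp: o_def)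
  moreover have "strict_mono (r \<circ> r')" using r r' by (rule strict_mono_o)
  ultimately show ?case by blast
qed

section \<open>Subsemigroups of the integer lattice\<close>

text \<open>The factor is \<open>Suc m\<close> because the zero multiple need not lie in
  \<open>P\<close>.\<close>

lemma nat_multiple_in_semigroup:
  fixes P :: "(nat \<Rightarrow> int) set"
  assumes "\<And>p q. p \<in> P \<Longrightarrow> q \<in> P \<Longrightarrow> p + q \<in> P" "p \<in> P"
  shows "(\<lambda>i. int (Suc m) * p i) \<in> P"
proof (induction m)
  case 0
  then show ?case using assms by simp
next
  case (Suc m)
  have "(\<lambda>i. int (Suc (Suc m)) * p i) = (\<lambda>i. int (Suc m) * p i) + p"
    by (auto simp: fun_eq_iff algebra_simps)
  then show ?case using assms Suc by metis
qed

text \<open>Links semigroups to Gordan's theorem: a nontrivial nonnegative relation among elements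
  of \<open>P\<close> would put 0 into \<open>P\<close>. Terms with coefficient 0 must be dropped
  rather than added, which is the reason for the case distinctions.\<close>

lemma nonneg_combination_in_semigroup:
  fixes P :: "(nat \<Rightarrow> int) set"
  assumes add: "\<And>p q. p \<in> P \<Longrightarrow> q \<in> P \<Longrightarrow> p + q \<in> P"
    and "finite S" "S \<subseteq> P" "\<forall>s\<in>S. 0 \<le> t s" "\<exists>s\<in>S. t s \<noteq> 0"
  shows "(\<lambda>i. \<Sum>s\<in>S. t s * s i) \<in> P"
  using assms(2-)
proof (induction S rule: finite_induct)
  case empty
  then show ?case by simp
next
  case (insert w S)
  have tw: "(\<lambda>i. t w * w i) \<in> P" if "t w \<noteq> 0"
  proof -
    have "t w = int (Suc (nat (t w) - 1))" using that insert.prems by auto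
    then show ?thesis
      using nat_multiple_in_semigroup[OF add, of w "nat (t w) - 1"] insert.prems by auto
  qed
  show ?case
  proof (cases "\<exists>s\<in>S. t s \<noteq> 0")
    case True
    then have S: "(\<lambda>i. \<Sum>s\<in>S. t s * s i) \<in> P" using insert by auto
    show ?thesis
    proof (cases "t w = 0")
      case True
      then show ?thesis using S insert.hyps by simp
    next
      case False
      have "(\<lambda>i. \<Sum>s\<in>insert w S. t s * s i) = (\<lambda>i. t w * w i) + (\<lambda>i. \<Sum>s\<in>S. t s * s i)"
        using insert.hyps by (auto simp: fun_eq_iff)
      then show ?thesis using add[OF tw[OF False] S] by simp
    qed
  next
    case False
    then have "t w \<noteq> 0" using insert.prems by blast
    moreover have "(\<lambda>i. \<Sum>s\<in>insert w S. t s * s i) = (\<lambda>i. t w * w i)"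
      using insert.hyps False by (auto simp: fun_eq_iff)
    ultimately show ?thesis using tw by simp
  qed
qed

text \<open>Integer vectors of length \<open>n\<close> are encoded as functions vanishing from
  \<open>n\<close> on, so that pointwise addition, negation and equality of functions are those of
  vectors.\<close>

definition supported :: "nat \<Rightarrow> (nat \<Rightarrow> int) set" where
  "supported n = {z. \<forall>i\<ge>n. z i = 0}"

lemma finite_bounded_supported: "finite {z \<in> supported n. \<forall>i<n. \<bar>z i\<bar> \<le> B}"
proof (rule finite_subset)
  show "{z \<in> supported n. \<forall>i<n. \<bar>z i\<bar> \<le> B} \<subseteq>
    {z. \<forall>i. (i \<in> {..<n} \<longrightarrow> z i \<in> {-B..B}) \<and> (i \<notin> {..<n} \<longrightarrow> z i = 0)}"
    by (force simp: supported_def abs_le_iff)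
qed (rule finite_set_of_finite_funs, auto)

section \<open>A nonzero functional that is nonnegative on the semigroup\<close>

text \<open>
  The coordinates in \<open>J\<close> parametrise the real span of \<open>P\<close>; the functional has to be nonzero on
  this span, which is why it is expressed in them.
\<close>

lemma nonneg_functional_exists:
  fixes P :: "(nat \<Rightarrow> int) set"
  assumes supp: "P \<subseteq> supported n"
    and add: "\<And>p q. p \<in> P \<Longrightarrow> q \<in> P \<Longrightarrow> p + q \<in> P"
    and zero: "0 \<notin> P" and ne: "P \<noteq> {}" and J: "finite J"
    and A: "\<And>p i. p \<in> P \<Longrightarrow> i < n \<Longrightarrow> real_of_int (p i) = (\<Sum>j\<in>J. A i j * real_of_int (p j))"
  shows "\<exists>g :: nat \<Rightarrow> real. (\<exists>j\<in>J. g j \<noteq> 0) \<and> (\<forall>p\<in>P. 0 \<le> (\<Sum>j\<in>J. g j * p j))"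
proof -
  obtain p0 where p0: "p0 \<in> P" using ne by blast
  have "\<exists>g :: nat \<Rightarrow> real. (\<Sum>j\<in>J. \<bar>g j\<bar>) = 1 \<and>
      (\<forall>p\<in>P. (\<forall>i<n. \<bar>p i\<bar> \<le> int k) \<longrightarrow> 0 \<le> (\<Sum>j\<in>J. g j * p j))" for k
  proof -
    \<comment> \<open>The part of \<open>P\<close> in a box is finite, and the boxes exhaust
      \<open>P\<close>. Inserting \<open>p0\<close> keeps \<open>S\<close> nonempty, which forces
      the functional found below to be nonzero.\<close>
    define S where "S = insert p0 {p \<in> P. \<forall>i<n. \<bar>p i\<bar> \<le> int k}"
    have SP: "S \<subseteq> P" using p0 by (auto simp: S_def)
    have finS: "finite S"
      unfolding S_def using supp by (auto intro: finite_subset[OF _ finite_bounded_supported[of n "int k"]])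
    have "\<exists>f. \<forall>s\<in>S. 0 < (\<Sum>i<n. f i * s i)"
    proof (rule gordan_int[OF finS])
      fix t assume t: "\<forall>s\<in>S. 0 \<le> t s" and z: "\<forall>i<n. (\<Sum>s\<in>S. t s * s i) = 0"
      have "(\<Sum>s\<in>S. t s * s i) = 0" for i
      proof (cases "i < n")
        case False
        then show ?thesis using SP supp by (intro sum.neutral) (auto simp: supported_def)
      qed (use z in blast)
      then have "(\<lambda>i. \<Sum>s\<in>S. t s * s i) = 0" by (simp add: fun_eq_iff)
      then show "\<forall>s\<in>S. t s = 0"
        using nonneg_combination_in_semigroup[OF add finS SP t] zero by auto
    qed
    then obtain f where f: "\<And>s. s \<in> S \<Longrightarrow> 0 < (\<Sum>i<n. f i * s i)" by blast
    \<comment> \<open>The functional \<open>f\<close> rewritten in the coordinates from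
      \<open>J\<close>: substituting \<open>A\<close> for the entries of \<open>s\<close> and
      collecting the terms at each \<open>j\<close> leaves its value on \<open>S\<close>
      unchanged.\<close>
    define g where "g j = (\<Sum>i<n. real_of_int (f i) * A i j)" for j
    have gs: "0 < (\<Sum>j\<in>J. g j * s j)" if "s \<in> S" for s
    proof -
      have "(\<Sum>j\<in>J. g j * s j) = (\<Sum>i<n. f i * (\<Sum>j\<in>J. A i j * s j))"
        unfolding g_def sum_distrib_left sum_distrib_right
        by (subst sum.swap) (simp add: algebra_simps)
      also have "\<dots> = (\<Sum>i<n. real_of_int (f i) * real_of_int (s i))"
        using that SP by (intro sum.cong refl) (simp add: A[symmetric] subset_iff)
      also have "\<dots> = real_of_int (\<Sum>i<n. f i * s i)" by simp
      also have "\<dots> > 0" using f[OF that] by (simp only: of_int_0_less_iff)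
      finally show ?thesis .
    qed
    \<comment> \<open>Dividing by this norm places all the functionals on the unit sphere, so that
      they are bounded and their limit cannot be 0.\<close>
    define c where "c = (\<Sum>j\<in>J. \<bar>g j\<bar>)"
    have "c \<noteq> 0"
    proof
      assume "c = 0"
      then have "\<forall>j\<in>J. g j = 0" unfolding c_def using J by (subst (asm) sum_nonneg_eq_0_iff) auto
      then show False using gs[of p0] by (simp add: S_def)
    qed
    moreover have "c \<ge> 0" by (simp add: c_def sum_nonneg)
    ultimately have c: "c > 0" by simp
    have "(\<Sum>j\<in>J. \<bar>g j / c\<bar>) = 1"
      using c by (simp add: c_def sum_divide_distrib[symmetric])
    moreover have "0 \<le> (\<Sum>j\<in>J. g j / c * p j)" if "p \<in> P" "\<forall>i<n. \<bar>p i\<bar> \<le> int k" for p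
    proof -
      have "(\<Sum>j\<in>J. g j / c * p j) = (\<Sum>j\<in>J. g j * p j) / c"
        by (simp add: sum_divide_distrib)
      then show ?thesis using gs[of p] that c by (simp add: S_def)
    qed
    ultimately show ?thesis by (intro exI[of _ "\<lambda>j. g j / c"]) blast
  qed
  then obtain g :: "nat \<Rightarrow> nat \<Rightarrow> real" where norm: "\<And>k. (\<Sum>j\<in>J. \<bar>g k j\<bar>) = 1"
    and g: "\<And>k p. p \<in> P \<Longrightarrow> (\<forall>i<n. \<bar>p i\<bar> \<le> int k) \<Longrightarrow> 0 \<le> (\<Sum>j\<in>J. g k j * p j)"
    by metis
  have "\<bar>g k j\<bar> \<le> 1" if "j \<in> J" for k j
    using member_le_sum[of j J "\<lambda>j. \<bar>g k j\<bar>"] that J norm[of k] by simp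
  then obtain l r where r: "strict_mono r" and l: "\<And>j. j \<in> J \<Longrightarrow> (\<lambda>k. g (r k) j) \<longlonglongrightarrow> l j"
    using bounded_family_convergent_subseq[OF J, of g 1] by blast
  have "(\<lambda>k. \<Sum>j\<in>J. \<bar>g (r k) j\<bar>) \<longlonglongrightarrow> (\<Sum>j\<in>J. \<bar>l j\<bar>)"
    using l by (intro tendsto_intros)
  then have "(\<Sum>j\<in>J. \<bar>l j\<bar>) = 1"
    by (simp add: norm LIMSEQ_const_iff)
  then have "\<exists>j\<in>J. l j \<noteq> 0" by (metis abs_zero sum.neutral zero_neq_one)
  moreover have "0 \<le> (\<Sum>j\<in>J. l j * p j)" if p: "p \<in> P" for p
  proof (rule LIMSEQ_le_const)
    show "(\<lambda>k. \<Sum>j\<in>J. g (r k) j * p j) \<longlonglongrightarrow> (\<Sum>j\<in>J. l j * p j)"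
      using l by (intro tendsto_intros)
    \<comment> \<open>A fixed \<open>p\<close> lies in all boxes of size at least \<open>K\<close>,
      and \<open>r k\<close> \<ge> \<open>k\<close>, so all but finitely many members of the
      subsequence are nonnegative at \<open>p\<close>.\<close>
    define K where "K = nat (\<Sum>i<n. \<bar>p i\<bar>)"
    have "0 \<le> (\<Sum>j\<in>J. g (r k) j * p j)" if "K \<le> k" for k
    proof (rule g[OF p], intro allI impI)
      fix i assume "i < n"
      then have "\<bar>p i\<bar> \<le> (\<Sum>i<n. \<bar>p i\<bar>)" by (intro member_le_sum) auto
      then have "\<bar>p i\<bar> \<le> int K" by (simp add: K_def)
      moreover have "K \<le> r k" using that seq_suble[OF r, of k] by simp
      ultimately show "\<bar>p i\<bar> \<le> int (r k)" by simp
    qed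
    then show "\<exists>N. \<forall>k\<ge>N. 0 \<le> (\<Sum>j\<in>J. g (r k) j * p j)" by blast
  qed
  ultimately show ?thesis by blast
qed

section \<open>Recursive construction of the rows\<close>

text \<open>\<open>G\<close> stands for the vectors killed by the rows chosen so far, and
  \<open>A\<close> records that on \<open>G\<close> the coordinates in \<open>J\<close> determine
  all others linearly. A new row that is nonzero in some coordinate of \<open>J\<close> allows this
  coordinate to be eliminated on its kernel, so \<open>J\<close> shrinks; \<open>P\<close> stays
  fixed throughout.\<close>

lemma lex_functionals_exist:
  fixes P G :: "(nat \<Rightarrow> int) set"
  assumes "P \<subseteq> supported n"
    and add: "\<And>p q. p \<in> P \<Longrightarrow> q \<in> P \<Longrightarrow> p + q \<in> P"
    and zero: "0 \<notin> P"
    and incomp: "\<And>p z. p \<in> P \<Longrightarrow> z \<in> supported n \<Longrightarrow> z \<notin> P \<Longrightarrow> - z \<notin> P \<Longrightarrow> p + z \<in> P"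
    and "finite J" "J \<subseteq> {..<n}" "G \<subseteq> supported n"
    and "\<And>x y. x \<in> G \<Longrightarrow> y \<in> G \<Longrightarrow> x + y \<in> G" "\<And>x. x \<in> G \<Longrightarrow> - x \<in> G"
    and "\<And>x i. x \<in> G \<Longrightarrow> i < n \<Longrightarrow> real_of_int (x i) = (\<Sum>j\<in>J. A i j * real_of_int (x j))"
  shows "\<exists>m>0. \<exists>F :: nat \<Rightarrow> nat \<Rightarrow> real. \<forall>z\<in>G.
    z \<in> P \<longleftrightarrow> (\<exists>r<m. 0 < (\<Sum>i<n. F r i * z i) \<and> (\<forall>q<r. (\<Sum>i<n. F q i * z i) = 0))"
  using assms(5-)
proof (induction J arbitrary: G A rule: finite_psubset_induct)
  case (psubset J G A)
  note G_add = psubset.prems(3) and G_uminus = psubset.prems(4) and A = psubset.prems(5)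
  show ?case
  proof (cases "P \<inter> G = {}")
    case True
    then show ?thesis
      \<comment> \<open>With no element of \<open>P\<close> left in \<open>G\<close>, a single zero
        row is enough, as it is never positive.\<close>
      by (intro exI[of _ 1] exI[of _ "\<lambda>_ _. 0"] conjI) auto
  next
    case False
    then obtain p where p: "p \<in> P" "p \<in> G" by blast
    have "\<exists>g :: nat \<Rightarrow> real. (\<exists>j\<in>J. g j \<noteq> 0) \<and> (\<forall>p\<in>P \<inter> G. 0 \<le> (\<Sum>j\<in>J. g j * p j))"
    proof (rule nonneg_functional_exists[where n = n and A = A])
      show "p + q \<in> P \<inter> G" if "p \<in> P \<inter> G" "q \<in> P \<inter> G" for p q
        using that add G_add by blast
    qed (use assms(1) zero False psubset.hyps A in auto)
    then obtain g :: "nat \<Rightarrow> real" and a where a: "a \<in> J" "g a \<noteq> 0"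
      and g: "\<And>p. p \<in> P \<Longrightarrow> p \<in> G \<Longrightarrow> 0 \<le> (\<Sum>j\<in>J. g j * p j)"
      by blast
    define \<phi> where "\<phi> z = (\<Sum>j\<in>J. g j * real_of_int (z j))" for z :: "nat \<Rightarrow> int"
    have \<phi>_add: "\<phi> (x + y) = \<phi> x + \<phi> y" for x y
      by (simp add: \<phi>_def sum.distrib algebra_simps)
    have \<phi>_uminus: "\<phi> (- x) = - \<phi> x" for x
      by (simp add: \<phi>_def sum_negf)
    \<comment> \<open>Adding \<open>z\<close> repeatedly to \<open>p\<close> stays in
      \<open>P\<close> and in \<open>G\<close>, where \<open>\<phi>\<close> is nonnegative. A
      negative \<open>\<phi> z\<close> would contradict this for a large number of
      additions.\<close>
    have incomp0: "\<phi> z \<ge> 0" if z: "z \<in> G" "z \<notin> P" "- z \<notin> P" for z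
    proof -
      have mult: "\<exists>y. y \<in> P \<and> y \<in> G \<and> \<phi> y = \<phi> p + real k * \<phi> z" for k
      proof (induction k)
        case 0
        then show ?case using p by auto
      next
        case (Suc k)
        then obtain y where y: "y \<in> P" "y \<in> G" "\<phi> y = \<phi> p + real k * \<phi> z" by blast
        have "y + z \<in> P" using incomp y z psubset.prems(2) by blast
        moreover have "y + z \<in> G" using G_add y z by blast
        moreover have "\<phi> (y + z) = \<phi> p + real (Suc k) * \<phi> z"
          by (simp add: \<phi>_add y algebra_simps)
        ultimately show ?case by blast
      qed
      show ?thesis
      proof (rule ccontr)
        assume "\<not> \<phi> z \<ge> 0"
        then obtain k :: nat where k: "\<phi> p < real k * - \<phi> z"
          using reals_Archimedean3[of "- \<phi> z"] by auto
        obtain y where "y \<in> P" "y \<in> G" "\<phi> y = \<phi> p + real k * \<phi> z" using mult by blast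
        then show False using g[of y] k by (simp add: \<phi>_def)
      qed
    qed
    \<comment> \<open>As \<open>\<phi>\<close> is negative at \<open>- z\<close>, that vector is not
      in \<open>P\<close>. Were \<open>z\<close> outside \<open>P\<close> too,
      \<open>incomp0\<close> would apply to \<open>- z\<close> and contradict the sign.\<close>
    have pos: "z \<in> P" if "z \<in> G" "\<phi> z > 0" for z
    proof (rule ccontr)
      assume nz: "z \<notin> P"
      have "- z \<notin> P" using g[of "- z"] G_uminus that \<phi>_uminus[of z] by (auto simp: \<phi>_def)
      then have "\<phi> (- z) \<ge> 0"
        by (intro incomp0 G_uminus that(1)) (simp_all only: minus_minus nz not_False_eq_True)
      then show False using that by (simp add: \<phi>_uminus)
    qed
    define G' where "G' = {z \<in> G. \<phi> z = 0}"
    \<comment> \<open>On the kernel the equation \<open>\<phi> x = 0\<close> can be solved for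
      \<open>x a\<close>, because \<open>g a\<close> is nonzero; \<open>A'\<close> results from
      substituting the solution into the representation by \<open>A\<close>.\<close>
    define A' where "A' i j = A i j - A i a * (g j / g a)" for i j
    have "\<exists>m>0. \<exists>F :: nat \<Rightarrow> nat \<Rightarrow> real. \<forall>z\<in>G'.
      z \<in> P \<longleftrightarrow> (\<exists>r<m. 0 < (\<Sum>i<n. F r i * z i) \<and> (\<forall>q<r. (\<Sum>i<n. F q i * z i) = 0))"
    proof (rule psubset.IH[of "J - {a}" G' A'])
      show "J - {a} \<subset> J" using a by blast
      show "J - {a} \<subseteq> {..<n}" "G' \<subseteq> supported n"
        using psubset.prems by (auto simp: G'_def)
      show "x + y \<in> G'" if "x \<in> G'" "y \<in> G'" for x y
        using that unfolding G'_def mem_Collect_eq by (intro conjI G_add) (simp_all add: \<phi>_add)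
      show "- x \<in> G'" if "x \<in> G'" for x
        using that unfolding G'_def mem_Collect_eq by (intro conjI G_uminus) (simp_all add: \<phi>_uminus)
      show "real_of_int (x i) = (\<Sum>j\<in>J - {a}. A' i j * real_of_int (x j))" if "x \<in> G'" "i < n" for x i
      proof -
        have "g a * x a + (\<Sum>j\<in>J - {a}. g j * x j) = 0"
          using that psubset.hyps a by (simp add: G'_def \<phi>_def sum.remove)
        then have xa: "real_of_int (x a) = - (\<Sum>j\<in>J - {a}. g j / g a * x j)"
          using a by (simp add: sum_divide_distrib[symmetric] field_simps)
        have "real_of_int (x i) = A i a * x a + (\<Sum>j\<in>J - {a}. A i j * x j)"
          using A[of x i] that psubset.hyps a by (simp add: G'_def sum.remove)
        also have "\<dots> = (\<Sum>j\<in>J - {a}. A' i j * real_of_int (x j))"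
          unfolding xa by (simp add: A'_def sum_subtractf sum_distrib_left algebra_simps)
        finally show ?thesis .
      qed
    qed
    then obtain m and F :: "nat \<Rightarrow> nat \<Rightarrow> real" where F: "\<forall>z\<in>G'.
      z \<in> P \<longleftrightarrow> (\<exists>r<m. 0 < (\<Sum>i<n. F r i * z i) \<and> (\<forall>q<r. (\<Sum>i<n. F q i * z i) = 0))"
      by (elim exE conjE)
    \<comment> \<open>The new functional goes in front as row 0, padded with zeros outside
      \<open>J\<close>, and the rows for the kernel move up by one.\<close>
    define F' where "F' r = (case r of 0 \<Rightarrow> (\<lambda>i. if i \<in> J then g i else 0) | Suc q \<Rightarrow> F q)" for r
    have F'0: "(\<Sum>i<n. F' 0 i * real_of_int (z i)) = \<phi> z" for z
    proof -
      have "(\<Sum>i<n. F' 0 i * real_of_int (z i)) = (\<Sum>i<n. if i \<in> J then g i * z i else 0)"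
        by (intro sum.cong) (auto simp: F'_def)
      also have "\<dots> = (\<Sum>i\<in>{..<n} \<inter> J. g i * z i)"
        by (simp add: sum.inter_restrict)
      also have "{..<n} \<inter> J = J" using psubset.prems by blast
      finally show ?thesis by (simp add: \<phi>_def)
    qed
    have F'Suc: "F' (Suc q) = F q" for q by (simp add: F'_def)
    have "z \<in> P \<longleftrightarrow> (\<exists>r<Suc m. 0 < (\<Sum>i<n. F' r i * z i) \<and> (\<forall>q<r. (\<Sum>i<n. F' q i * z i) = 0))"
      if z: "z \<in> G" for z
    proof -
      have *: "(\<exists>r<Suc m. 0 < (\<Sum>i<n. F' r i * z i) \<and> (\<forall>q<r. (\<Sum>i<n. F' q i * z i) = 0)) \<longleftrightarrow>
        \<phi> z > 0 \<or> \<phi> z = 0 \<and> (\<exists>r<m. 0 < (\<Sum>i<n. F r i * z i) \<and> (\<forall>q<r. (\<Sum>i<n. F q i * z i) = 0))"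
        by (simp only: Ex_less_Suc2 All_less_Suc2 F'0 F'Suc) auto
      consider "\<phi> z > 0" | "\<phi> z = 0" | "\<phi> z < 0" by linarith
      then show ?thesis
      proof cases
        case 1
        then show ?thesis using pos z * by simp
      next
        case 2
        then show ?thesis using bspec[OF F, of z] z * by (simp add: G'_def)
      next
        case 3
        then show ?thesis using g[of z] z * by (auto simp: \<phi>_def)
      qed
    qed
    then show ?thesis by blast
  qed
qed

section \<open>From monomial preorders to exponent differences\<close>

lemma xpow_add:
  assumes "a \<in> carrier_vec n" "b \<in> carrier_vec n"
  shows "(xpow (a + b) :: 'k::field mpoly) = xpow a * xpow b"
proof -
  have "(xpow (a + b) :: 'k mpoly) = (\<Prod>i<n. X i ^ (a $ i) * X i ^ (b $ i))"
    using assms unfolding xpow_def by (intro prod.cong) (auto simp: power_add)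
  also have "\<dots> = xpow a * xpow b"
    using assms by (simp add: xpow_def prod.distrib)
  finally show ?thesis .
qed

definition vdiff :: "nat \<Rightarrow> nat vec \<Rightarrow> nat vec \<Rightarrow> nat \<Rightarrow> int" where
  "vdiff n a b = (\<lambda>i. if i < n then int (b $ i) - int (a $ i) else 0)"

definition exponent_differences :: "nat \<Rightarrow> ('k::field mpoly \<Rightarrow> 'k mpoly \<Rightarrow> bool) \<Rightarrow> (nat \<Rightarrow> int) set" where
  "exponent_differences n lt =
     {vdiff n a b | a b. a \<in> carrier_vec n \<and> b \<in> carrier_vec n \<and> lt (xpow a) (xpow b)}"

context
  fixes n :: nat and lt :: "'k::field mpoly \<Rightarrow> 'k mpoly \<Rightarrow> bool"
  assumes preorder: "monomial_preorder n lt"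
begin

private abbreviation (input) mless :: "nat vec \<Rightarrow> nat vec \<Rightarrow> bool" where
  "mless a b \<equiv> lt (xpow a) (xpow b)"

private lemma xpow_monomials: "a \<in> carrier_vec n \<Longrightarrow> xpow a \<in> (monomials n :: 'k mpoly set)"
  by (simp add: monomials_def)

private lemma less_add_iff:
  assumes "a \<in> carrier_vec n" "b \<in> carrier_vec n" "c \<in> carrier_vec n"
  shows "mless (a + c) (b + c) \<longleftrightarrow> mless a b"
  using preorder assms unfolding monomial_preorder_def by (metis xpow_add)

private lemma less_irrefl: "a \<in> carrier_vec n \<Longrightarrow> \<not> mless a a"
  using preorder xpow_monomials[of a]
  by (auto simp: monomial_preorder_def weak_order_on_def strict_partial_order_on_def irreflp_on_def)

private lemma less_trans:
  assumes "a \<in> carrier_vec n" "b \<in> carrier_vec n" "c \<in> carrier_vec n" "mless a b" "mless b c"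
  shows "mless a c"
  using preorder assms(4,5) xpow_monomials[OF assms(1)] xpow_monomials[OF assms(2)]
    xpow_monomials[OF assms(3)]
  unfolding monomial_preorder_def weak_order_on_def strict_partial_order_on_def
  by (meson transp_onD)

private lemma incomparable_trans:
  assumes "a \<in> carrier_vec n" "b \<in> carrier_vec n" "c \<in> carrier_vec n"
    "incomparable lt (xpow a) (xpow b)" "incomparable lt (xpow b) (xpow c)"
  shows "incomparable lt (xpow a) (xpow c)"
proof -
  have "trans {(s, t). s \<in> monomials n \<and> t \<in> monomials n \<and> incomparable lt s t}"
    using preorder by (auto simp: monomial_preorder_def weak_order_on_def equiv_def)
  from transD[OF this, of "xpow a" "xpow b" "xpow c"] show ?thesis
    using assms xpow_monomials by auto
qed

text \<open>If \<open>c\<close> were below \<open>a\<close>, it would be below \<open>b\<close> by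
  transitivity. If \<open>c\<close> were incomparable to \<open>a\<close>, then so would
  \<open>b\<close> be, by transitivity of incomparability.\<close>

private lemma less_incomparable_trans:
  assumes "a \<in> carrier_vec n" "b \<in> carrier_vec n" "c \<in> carrier_vec n"
    "mless a b" "incomparable lt (xpow b) (xpow c)"
  shows "mless a c"
proof (rule ccontr)
  assume nac: "\<not> mless a c"
  show False
  proof (cases "mless c a")
    case True
    then show ?thesis using less_trans[of c a b] assms by (auto simp: incomparable_def)
  next
    case False
    then have "incomparable lt (xpow a) (xpow b)"
      using incomparable_trans[of a c b] nac assms by (auto simp: incomparable_def)
    then show ?thesis using assms by (auto simp: incomparable_def)
  qed
qed

text \<open>Membership does not depend on the chosen representatives: two pairs with the same
  difference become equal after translation, by \<open>b\<close> for one and by \<open>b'\<close>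
  for the other, and the preorder is invariant under translation in both directions.\<close>

private lemma vdiff_in_exponent_differences_iff:
  assumes "a \<in> carrier_vec n" "b \<in> carrier_vec n"
  shows "vdiff n a b \<in> exponent_differences n lt \<longleftrightarrow> mless a b"
proof
  assume "vdiff n a b \<in> exponent_differences n lt"
  then obtain a' b' where *: "a' \<in> carrier_vec n" "b' \<in> carrier_vec n" "mless a' b'"
    "vdiff n a b = vdiff n a' b'"
    by (auto simp: exponent_differences_def)
  have "a' + b = a + b'"
  proof (rule eq_vecI)
    fix i assume "i < dim_vec (a + b')"
    then have "i < n" using * by simp
    then show "(a' + b) $ i = (a + b') $ i"
      using fun_cong[OF *(4), of i] * assms by (simp add: vdiff_def)
  qed (use * assms in simp)
  moreover have "mless (a' + b) (b' + b)" using less_add_iff * assms by blast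
  ultimately have "mless (a + b') (b + b')"
    using comm_add_vec[OF assms(2) *(2)] by simp
  then show "mless a b" using less_add_iff * assms by blast
qed (use assms in \<open>auto simp: exponent_differences_def\<close>)

private lemma supported_eq_vdiff:
  assumes "z \<in> supported n"
  obtains a b where "a \<in> carrier_vec n" "b \<in> carrier_vec n" "z = vdiff n a b"
proof
  \<comment> \<open>The negative and the positive part of \<open>z\<close>; \<open>nat\<close> cuts
    off the other sign.\<close>
  show "z = vdiff n (vec n (\<lambda>i. nat (- z i))) (vec n (\<lambda>i. nat (z i)))"
    using assms by (auto simp: vdiff_def supported_def fun_eq_iff)
qed auto

private lemma vdiff_add:
  assumes "a \<in> carrier_vec n" "b \<in> carrier_vec n" "c \<in> carrier_vec n" "d \<in> carrier_vec n"
  shows "vdiff n a b + vdiff n c d = vdiff n (a + c) (b + d)"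
  using assms by (auto simp: vdiff_def fun_eq_iff)

private lemma vdiff_uminus: "- vdiff n a b = vdiff n b a"
  by (auto simp: vdiff_def fun_eq_iff)

text \<open>Translation gives \<open>a + c\<close> below \<open>b + c\<close>, and
  \<open>b + c\<close> incomparable to \<open>b + d\<close>; the order passes across the
  incomparable pair.\<close>

private lemma exponent_differences_add_incomparable:
  assumes p: "p \<in> exponent_differences n lt" and z: "z \<in> supported n"
    and nz: "z \<notin> exponent_differences n lt" "- z \<notin> exponent_differences n lt"
  shows "p + z \<in> exponent_differences n lt"
proof -
  obtain a b where ab: "a \<in> carrier_vec n" "b \<in> carrier_vec n" "mless a b" "p = vdiff n a b"
    using p by (auto simp: exponent_differences_def)
  obtain c d where cd: "c \<in> carrier_vec n" "d \<in> carrier_vec n" "z = vdiff n c d"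
    using supported_eq_vdiff[OF z] .
  have "incomparable lt (xpow (b + c)) (xpow (b + d))"
    using nz less_add_iff[of c d b] less_add_iff[of d c b] ab cd
    by (simp add: incomparable_def vdiff_uminus vdiff_in_exponent_differences_iff comm_add_vec[of b n])
  moreover have "mless (a + c) (b + c)" using less_add_iff ab cd by blast
  ultimately have "mless (a + c) (b + d)"
    using less_incomparable_trans[of "a + c" "b + c" "b + d"] ab cd by simp
  then show ?thesis
    using vdiff_in_exponent_differences_iff[of "a + c" "b + d"] ab cd by (simp add: vdiff_add)
qed

private lemma exponent_differences_add:
  assumes "p \<in> exponent_differences n lt" "z \<in> exponent_differences n lt"
  shows "p + z \<in> exponent_differences n lt"
proof -
  obtain a b where ab: "a \<in> carrier_vec n" "b \<in> carrier_vec n" "mless a b" "p = vdiff n a b"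
    using assms by (auto simp: exponent_differences_def)
  obtain c d where cd: "c \<in> carrier_vec n" "d \<in> carrier_vec n" "mless c d" "z = vdiff n c d"
    using assms by (auto simp: exponent_differences_def)
  have "mless (a + c) (b + c)" using less_add_iff ab cd by blast
  moreover have "mless (b + c) (b + d)"
    using less_add_iff[of c d b] ab cd by (simp add: comm_add_vec[of b n])
  ultimately have "mless (a + c) (b + d)"
    using less_trans[of "a + c" "b + c" "b + d"] ab cd by simp
  then show ?thesis
    using vdiff_in_exponent_differences_iff[of "a + c" "b + d"] ab cd by (simp add: vdiff_add)
qed

lemma monomial_preorder_lex_functionals:
  "\<exists>m>0. \<exists>F :: nat \<Rightarrow> nat \<Rightarrow> real. \<forall>a\<in>carrier_vec n. \<forall>b\<in>carrier_vec n.
    lt (xpow a) (xpow b) \<longleftrightarrow> (\<exists>r<m. 0 < (\<Sum>i<n. F r i * vdiff n a b i) \<and>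
      (\<forall>q<r. (\<Sum>i<n. F q i * vdiff n a b i) = 0))"
proof -
  let ?P = "exponent_differences n lt"
  have "\<exists>m>0. \<exists>F :: nat \<Rightarrow> nat \<Rightarrow> real. \<forall>z\<in>supported n.
    z \<in> ?P \<longleftrightarrow> (\<exists>r<m. 0 < (\<Sum>i<n. F r i * z i) \<and> (\<forall>q<r. (\<Sum>i<n. F q i * z i) = 0))"
  \<comment> \<open>The recursion starts from the whole lattice, with all coordinates free and the
    identity matrix as \<open>A\<close>.\<close>
  proof (rule lex_functionals_exist[where J = "{..<n}" and A = "\<lambda>i j. if i = j then 1 else 0"])
    show "?P \<subseteq> supported n"
      by (auto simp: exponent_differences_def vdiff_def supported_def)
    show "0 \<notin> ?P"
    proof
      assume "0 \<in> ?P"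
      moreover have "0 = vdiff n (0\<^sub>v n) (0\<^sub>v n)" by (auto simp: vdiff_def)
      ultimately show False
        using vdiff_in_exponent_differences_iff[of "0\<^sub>v n" "0\<^sub>v n"] less_irrefl[of "0\<^sub>v n"] by simp
    qed
    show "real_of_int (x i) = (\<Sum>j<n. (if i = j then 1 else 0) * real_of_int (x j))"
      if "i < n" for x i
    proof -
      have "(\<Sum>j<n. (if i = j then 1 else 0) * real_of_int (x j)) =
        (\<Sum>j<n. if i = j then real_of_int (x j) else 0)"
        by (intro sum.cong) auto
      then show ?thesis using that by simp
    qed
  qed (auto simp: supported_def intro: exponent_differences_add exponent_differences_add_incomparable)
  then obtain m and F :: "nat \<Rightarrow> nat \<Rightarrow> real" where "m > 0" and F: "\<forall>z\<in>supported n.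
    z \<in> ?P \<longleftrightarrow> (\<exists>r<m. 0 < (\<Sum>i<n. F r i * z i) \<and> (\<forall>q<r. (\<Sum>i<n. F q i * z i) = 0))"
    by (elim exE conjE)
  have "vdiff n a b \<in> supported n" for a b by (simp add: vdiff_def supported_def)
  then have "\<forall>a\<in>carrier_vec n. \<forall>b\<in>carrier_vec n. mless a b \<longleftrightarrow>
      (\<exists>r<m. 0 < (\<Sum>i<n. F r i * vdiff n a b i) \<and> (\<forall>q<r. (\<Sum>i<n. F q i * vdiff n a b i) = 0))"
    using F by (simp add: vdiff_in_exponent_differences_iff[symmetric])
  then show ?thesis using \<open>m > 0\<close> by (intro exI conjI)
qed

end

section \<open>The matrix and the lexicographic order\<close>

theorem theorem1p2:
  fixes n :: nat
    and lt :: "'k::field mpoly \<Rightarrow> 'k mpoly \<Rightarrow> bool"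
  assumes "monomial_preorder n lt"
  shows "\<exists>m>0. \<exists>M :: real mat. M \<in> carrier_mat m n \<and>
    (\<forall>a\<in>carrier_vec n. \<forall>b\<in>carrier_vec n.
       lt (xpow a) (xpow b) \<longleftrightarrow> M *\<^sub>v map_vec real a <\<^sub>l\<^sub>e\<^sub>x M *\<^sub>v map_vec real b)"
proof -
  obtain m and F :: "nat \<Rightarrow> nat \<Rightarrow> real" where "m > 0"
    and F: "\<And>a b. a \<in> carrier_vec n \<Longrightarrow> b \<in> carrier_vec n \<Longrightarrow>
      lt (xpow a) (xpow b) \<longleftrightarrow> (\<exists>r<m. 0 < (\<Sum>i<n. F r i * vdiff n a b i) \<and>
        (\<forall>q<r. (\<Sum>i<n. F q i * vdiff n a b i) = 0))"
    using monomial_preorder_lex_functionals[OF assms] by blast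
  \<comment> \<open>The functionals become the rows. The sign of row \<open>r\<close> on the
    difference of \<open>b\<close> and \<open>a\<close> then compares the entries at
    \<open>r\<close> of the two image vectors.\<close>
  define M where "M = mat m n (\<lambda>(r, i). F r i)"
  have "lt (xpow a) (xpow b) \<longleftrightarrow> M *\<^sub>v map_vec real a <\<^sub>l\<^sub>e\<^sub>x M *\<^sub>v map_vec real b"
    if a: "a \<in> carrier_vec n" and b: "b \<in> carrier_vec n" for a b
  proof -
    have Mv: "(M *\<^sub>v map_vec real c) $ r = (\<Sum>i<n. F r i * c $ i)"
      if "r < m" "c \<in> carrier_vec n" for r c
      using that by (simp add: M_def scalar_prod_def atLeast0LessThan)
    have diff: "(\<Sum>i<n. F r i * vdiff n a b i) =
        (M *\<^sub>v map_vec real b) $ r - (M *\<^sub>v map_vec real a) $ r" if "r < m" for r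
      unfolding Mv[OF that a] Mv[OF that b] sum_subtractf[symmetric]
      by (intro sum.cong) (auto simp: vdiff_def algebra_simps)
    have "(\<exists>r<m. 0 < (\<Sum>i<n. F r i * vdiff n a b i) \<and> (\<forall>q<r. (\<Sum>i<n. F q i * vdiff n a b i) = 0)) \<longleftrightarrow>
      (\<exists>r<m. (M *\<^sub>v map_vec real a) $ r < (M *\<^sub>v map_vec real b) $ r \<and>
        (\<forall>q<r. (M *\<^sub>v map_vec real a) $ q = (M *\<^sub>v map_vec real b) $ q))"
    proof (intro ex_cong1 conj_cong refl)
      show "(\<forall>q<r. (\<Sum>i<n. F q i * vdiff n a b i) = 0) \<longleftrightarrow>
        (\<forall>q<r. (M *\<^sub>v map_vec real a) $ q = (M *\<^sub>v map_vec real b) $ q)" if "r < m" for r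
        \<comment> \<open>Entries of the product are known only below \<open>m\<close>, so each
          \<open>q < r\<close> is first bounded through \<open>r < m\<close>.\<close>
        using diff less_trans[OF _ that] by force
    qed (use diff in simp)
    moreover have "dim_vec (M *\<^sub>v map_vec real a) = m" by (simp add: M_def)
    ultimately show ?thesis unfolding F[OF a b] lex_less_def by simp
  qed
  moreover have "M \<in> carrier_mat m n" by (simp add: M_def)
  ultimately show ?thesis using \<open>m > 0\<close> by blast
qed

end
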